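(* Let $G$ be a finite simple graph and let $v$ be a vertex of $G$. Then \[ Y_G = Y_{G-v} + (Y_v-1)\,Y_{G-N[v]} + \sum_{\alpha}X_G^{\alpha}, \] where $\alpha$ ranges over all maps from $V(G)$ to $\mathbb{N}$ such that $\alpha(v)\ge 1$ and $\alpha(u)\ge 1$ for some $u\in N(v)$.
   Context: $\mathbb{N}=\{0,1,2,\ldots\}$. $N(v)$ is the set of neighbors of $v$, $N[v]=\{v\}\cup N(v)$, and $G-v$, $G-N[v]$ are the graphs obtained from $G$ by deleting the vertex $v$, respectively all vertices of $N[v]$. $Y_v$ denotes $Y_H$ for $H$ the graph with the single vertex $v$. Let $\mathbf{x}=\{x_1,x_2,\ldots\}$ be indeterminates. For a finite simple graph $G$ and $\alpha:V(G)\to\mathbb{N}$, a multicoloring of $G$ of type $\alpha$ is a map $\kappa$ assigning to each vertex $w$ a finite set $\kappa(w)$ of positive integers with $|\kappa(w)|=\alpha(w)$; it is proper if $\kappa(w)\cap\kappa(w')=\emptyset$ for every edge $ww'$. Define $X_G^\alpha=\sum_\kappa x_1^{a_1}x_2^{a_2}\cdots$, summed over all proper multicolorings $\kappa$ of type $\alpha$, where $a_i$ is the number of vertices $w$ with $i\in\kappa(w)$. Define the formal power series $Y_G=\sum_{\alpha:V(G)\to\mathbb{N}}X_G^\alpha$ (for the graph with no vertices, $Y=1$). *)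

theory Defs
  imports Main "HOL-Library.FuncSet" "HOL-Library.Poly_Mapping"
begin

section \<open>Formal power series in the indeterminates \<open>x\<^sub>i\<close>, \<open>i :: nat\<close>\<close>

text \<open>
  A monomial is its exponent vector, a finitely supported function, so that addition of
  exponent vectors is multiplication of monomials. A series is an arbitrary
  family of coefficients.
\<close>

type_synonym monomial = "nat \<Rightarrow>\<^sub>0 nat"

typedef 'a mfps = "UNIV :: (monomial \<Rightarrow> 'a) set"
  morphisms mfps_coeff Abs_mfps ..

setup_lifting type_definition_mfps

lemma mfps_eqI: "(\<And>m. mfps_coeff f m = mfps_coeff g m) \<Longrightarrow> f = g"
  by (simp add: mfps_coeff_inject[symmetric] ext)

definition mono_splits :: "monomial \<Rightarrow> (monomial \<times> monomial) set" where
  "mono_splits m = {(a, b). a + b = m}"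

lemma finite_mono_splits: "finite (mono_splits m)"
proof -
  let ?K = "Poly_Mapping.keys m"
  let ?h = "\<lambda>p :: monomial \<times> monomial. restrict (Poly_Mapping.lookup (fst p)) ?K"
  have out: "Poly_Mapping.lookup a i = 0" if "a + b = m" "i \<notin> ?K" for a b :: monomial and i
    using that by (auto simp: in_keys_iff lookup_add)
  have "inj_on ?h (mono_splits m)"
  proof (rule inj_onI)
    fix p q assume p: "p \<in> mono_splits m" and q: "q \<in> mono_splits m" and e: "?h p = ?h q"
    obtain a b c d where [simp]: "p = (a, b)" "q = (c, d)" by (metis surj_pair)
    have ab: "a + b = m" and cd: "c + d = m" using p q by (auto simp: mono_splits_def)
    have "Poly_Mapping.lookup a i = Poly_Mapping.lookup c i" for i
    proof (cases "i \<in> ?K")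
      case True
      then show ?thesis using fun_cong[OF e, of i] by simp
    next
      case False
      then show ?thesis using out[OF ab] out[OF cd] by simp
    qed
    then have "a = c" by (rule poly_mapping_eqI)
    then show "p = q" using ab cd by auto
  qed
  moreover have "?h ` mono_splits m \<subseteq> (\<Pi>\<^sub>E i\<in>?K. {..Poly_Mapping.lookup m i})"
    by (auto simp: mono_splits_def lookup_add)
  moreover have "finite (\<Pi>\<^sub>E i\<in>?K. {..Poly_Mapping.lookup m i})"
    by (intro finite_PiE) auto
  ultimately show ?thesis by (metis finite_imageD finite_subset)
qed

instantiation mfps :: (comm_ring_1) comm_ring_1
begin

lift_definition zero_mfps :: "'a mfps" is "\<lambda>_. 0" .

lift_definition one_mfps :: "'a mfps" is "\<lambda>m. if m = 0 then 1 else 0" .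

lift_definition plus_mfps :: "'a mfps \<Rightarrow> 'a mfps \<Rightarrow> 'a mfps" is "\<lambda>f g m. f m + g m" .

lift_definition minus_mfps :: "'a mfps \<Rightarrow> 'a mfps \<Rightarrow> 'a mfps" is "\<lambda>f g m. f m - g m" .

lift_definition uminus_mfps :: "'a mfps \<Rightarrow> 'a mfps" is "\<lambda>f m. - f m" .

lift_definition times_mfps :: "'a mfps \<Rightarrow> 'a mfps \<Rightarrow> 'a mfps"
  is "\<lambda>f g m. \<Sum>(a, b)\<in>mono_splits m. f a * g b" .

instance
proof
  fix f g h :: "'a mfps"
  show "f + g + h = f + (g + h)" "f + g = g + f" "0 + f = f" "- f + f = 0" "f - g = f + - g"
    by (transfer; simp add: algebra_simps fun_eq_iff)+
  show "(0 :: 'a mfps) \<noteq> 1"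
    by transfer (auto simp: fun_eq_iff intro!: exI[of _ 0])
  show "(f + g) * h = f * h + g * h"
    by transfer (simp add: fun_eq_iff distrib_right sum.distrib case_prod_unfold)
  show "f * g = g * f"
  proof (transfer, rule ext)
    fix f g :: "monomial \<Rightarrow> 'a" and m
    show "(\<Sum>(a, b)\<in>mono_splits m. f a * g b) = (\<Sum>(a, b)\<in>mono_splits m. g a * f b)"
      by (rule sum.reindex_bij_witness[where i = prod.swap and j = prod.swap])
         (auto simp: mono_splits_def ac_simps)
  qed
  show "1 * f = f"
  proof (transfer, rule ext)
    fix f :: "monomial \<Rightarrow> 'a" and m
    have "(\<Sum>(a, b)\<in>mono_splits m. (if a = 0 then 1 else 0) * f b)
        = (\<Sum>(a, b)\<in>{(0 :: monomial, m)}. (if a = 0 then 1 else 0) * f b)"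
      by (rule sum.mono_neutral_right[OF finite_mono_splits]) (auto simp: mono_splits_def split: if_splits)
    then show "(\<Sum>(a, b)\<in>mono_splits m. (if a = 0 then 1 else 0) * f b) = f m" by simp
  qed
  show "f * g * h = f * (g * h)"
  proof (transfer, rule ext)
    fix f g h :: "monomial \<Rightarrow> 'a" and m
    have "(\<Sum>(d, c)\<in>mono_splits m. (\<Sum>(a, b)\<in>mono_splits d. f a * g b) * h c)
        = (\<Sum>p\<in>mono_splits m. \<Sum>q\<in>mono_splits (fst p). f (fst q) * g (snd q) * h (snd p))"
      by (simp add: case_prod_unfold sum_distrib_right)
    also have "\<dots> = (\<Sum>(p, q)\<in>(SIGMA p:mono_splits m. mono_splits (fst p)).
        f (fst q) * g (snd q) * h (snd p))"
      by (rule sum.Sigma) (auto simp: finite_mono_splits)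
    also have "\<dots> = (\<Sum>(p, q)\<in>(SIGMA p:mono_splits m. mono_splits (snd p)).
        f (fst p) * (g (fst q) * h (snd q)))"
      by (rule sum.reindex_bij_witness[where
            i = "\<lambda>(p, q). ((fst p + fst q, snd q), (fst p, fst q))" and
            j = "\<lambda>(p, q). ((fst q, snd q + snd p), (snd q, snd p))"])
         (auto simp: mono_splits_def ac_simps)
    also have "\<dots> = (\<Sum>p\<in>mono_splits m. \<Sum>q\<in>mono_splits (snd p).
        f (fst p) * (g (fst q) * h (snd q)))"
      by (rule sum.Sigma[symmetric]) (auto simp: finite_mono_splits)
    also have "\<dots> = (\<Sum>(a, d)\<in>mono_splits m. f a * (\<Sum>(b, c)\<in>mono_splits d. g b * h c))"
      by (simp add: case_prod_unfold sum_distrib_left)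
    finally show "(\<Sum>(d, c)\<in>mono_splits m. (\<Sum>(a, b)\<in>mono_splits d. f a * g b) * h c)
        = (\<Sum>(a, d)\<in>mono_splits m. f a * (\<Sum>(b, c)\<in>mono_splits d. g b * h c))" .
  qed
qed

end

definition mfps_monom :: "monomial \<Rightarrow> 'a::comm_ring_1 mfps" where
  "mfps_monom m = Abs_mfps (\<lambda>n. if n = m then 1 else 0)"

lemma mfps_coeff_monom: "mfps_coeff (mfps_monom m) n = (if n = m then 1 else 0)"
  by (simp add: mfps_monom_def Abs_mfps_inverse)

text \<open>
  Infinite sums of series are taken coefficientwise; \<open>sum'\<close> is the sum over the
  support, with junk value \<open>0\<close> if the support is infinite. All sums formed below are
  \<open>mfps_summable\<close>, so the junk value does not occur.
\<close>

definition mfps_summable :: "('i \<Rightarrow> 'a::comm_ring_1 mfps) \<Rightarrow> 'i set \<Rightarrow> bool" where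
  "mfps_summable F A \<longleftrightarrow> (\<forall>m. finite {a \<in> A. mfps_coeff (F a) m \<noteq> 0})"

definition mfps_sum :: "('i \<Rightarrow> 'a::comm_ring_1 mfps) \<Rightarrow> 'i set \<Rightarrow> 'a mfps" where
  "mfps_sum F A = Abs_mfps (\<lambda>m. sum' (\<lambda>a. mfps_coeff (F a) m) A)"

lemma mfps_coeff_sum: "mfps_coeff (mfps_sum F A) m = sum' (\<lambda>a. mfps_coeff (F a) m) A"
  by (simp add: mfps_sum_def Abs_mfps_inverse)


section \<open>Finite simple graphs\<close>

record 'v sgraph =
  verts :: "'v set"
  edges :: "'v set set"

definition finite_simple_graph :: "'v sgraph \<Rightarrow> bool" where
  "finite_simple_graph G \<longleftrightarrow> finite (verts G) \<and>
     (\<forall>e\<in>edges G. \<exists>u w. e = {u, w} \<and> u \<in> verts G \<and> w \<in> verts G \<and> u \<noteq> w)"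

definition nbrs :: "'v sgraph \<Rightarrow> 'v \<Rightarrow> 'v set" where
  "nbrs G v = {u. {v, u} \<in> edges G}"

definition closed_nbrs :: "'v sgraph \<Rightarrow> 'v \<Rightarrow> 'v set" where
  "closed_nbrs G v = insert v (nbrs G v)"

definition del_verts :: "'v sgraph \<Rightarrow> 'v set \<Rightarrow> 'v sgraph" where
  "del_verts G S = \<lparr>verts = verts G - S, edges = {e \<in> edges G. e \<inter> S = {}}\<rparr>"

definition single_vertex :: "'v \<Rightarrow> 'v sgraph" where
  "single_vertex v = \<lparr>verts = {v}, edges = {}\<rparr>"


section \<open>Proper multicolorings and the series \<open>X\<close> and \<open>Y\<close>\<close>

text \<open>
  Maps with domain \<open>verts G\<close> are the elements of a \<open>\<Pi>\<^sub>E\<close>: having a fixed value outside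
  \<open>verts G\<close>, they are counted once each.
\<close>

definition vertex_weights :: "'v sgraph \<Rightarrow> ('v \<Rightarrow> nat) set" where
  "vertex_weights G = verts G \<rightarrow>\<^sub>E UNIV"

definition multicolorings :: "'v sgraph \<Rightarrow> ('v \<Rightarrow> nat) \<Rightarrow> ('v \<Rightarrow> nat set) set" where
  "multicolorings G \<alpha> = (\<Pi>\<^sub>E w\<in>verts G. {C. finite C \<and> C \<subseteq> {1..} \<and> card C = \<alpha> w})"

definition proper_multicolorings :: "'v sgraph \<Rightarrow> ('v \<Rightarrow> nat) \<Rightarrow> ('v \<Rightarrow> nat set) set" where
  "proper_multicolorings G \<alpha> =
     {\<kappa> \<in> multicolorings G \<alpha>. \<forall>u w. {u, w} \<in> edges G \<longrightarrow> \<kappa> u \<inter> \<kappa> w = {}}"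

definition color_monomial :: "'v sgraph \<Rightarrow> ('v \<Rightarrow> nat set) \<Rightarrow> monomial" where
  "color_monomial G \<kappa> = Abs_poly_mapping (\<lambda>i. card {w \<in> verts G. i \<in> \<kappa> w})"

definition X_series :: "'v sgraph \<Rightarrow> ('v \<Rightarrow> nat) \<Rightarrow> int mfps" where
  "X_series G \<alpha> = mfps_sum (\<lambda>\<kappa>. mfps_monom (color_monomial G \<kappa>)) (proper_multicolorings G \<alpha>)"

definition Y_series :: "'v sgraph \<Rightarrow> int mfps" where
  "Y_series G = mfps_sum (X_series G) (vertex_weights G)"


section \<open>Well-definedness\<close>

lemma lookup_color_monomial:
  assumes "finite (verts G)" "\<kappa> \<in> multicolorings G \<alpha>"
  shows "Poly_Mapping.lookup (color_monomial G \<kappa>) i = card {w \<in> verts G. i \<in> \<kappa> w}"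
proof -
  have "{i. card {w \<in> verts G. i \<in> \<kappa> w} \<noteq> 0} \<subseteq> (\<Union>w\<in>verts G. \<kappa> w)"
    using assms(1) by (auto simp: card_eq_0_iff)
  moreover have "finite (\<Union>w\<in>verts G. \<kappa> w)"
    using assms by (auto simp: multicolorings_def PiE_iff)
  ultimately have "finite {i. card {w \<in> verts G. i \<in> \<kappa> w} \<noteq> 0}"
    by (rule finite_subset)
  then show ?thesis by (simp add: color_monomial_def Abs_poly_mapping_inverse)
qed

lemma finite_colorings_of_monomial:
  assumes "finite (verts G)"
  shows "finite {\<kappa>. (\<exists>\<alpha>. \<kappa> \<in> proper_multicolorings G \<alpha>) \<and> color_monomial G \<kappa> = m}"
proof (rule finite_subset)
  show "finite (\<Pi>\<^sub>E w\<in>verts G. Pow (Poly_Mapping.keys m))"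
    by (intro finite_PiE assms) auto
  show "{\<kappa>. (\<exists>\<alpha>. \<kappa> \<in> proper_multicolorings G \<alpha>) \<and> color_monomial G \<kappa> = m}
      \<subseteq> (\<Pi>\<^sub>E w\<in>verts G. Pow (Poly_Mapping.keys m))"
  proof clarify
    fix \<kappa> \<alpha> assume "\<kappa> \<in> proper_multicolorings G \<alpha>" and m: "m = color_monomial G \<kappa>"
    then have k: "\<kappa> \<in> multicolorings G \<alpha>" by (simp add: proper_multicolorings_def)
    have "\<kappa> w \<subseteq> Poly_Mapping.keys m" if "w \<in> verts G" for w
      using that assms
      by (auto simp: m in_keys_iff lookup_color_monomial[OF assms k] card_eq_0_iff)
    then show "\<kappa> \<in> (\<Pi>\<^sub>E w\<in>verts G. Pow (Poly_Mapping.keys (color_monomial G \<kappa>)))"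
      using k m by (auto simp: multicolorings_def PiE_iff)
  qed
qed

lemma X_summable:
  assumes "finite (verts G)"
  shows "mfps_summable (\<lambda>\<kappa>. mfps_monom (color_monomial G \<kappa>) :: int mfps)
           (proper_multicolorings G \<alpha>)"
  unfolding mfps_summable_def
proof
  fix m
  show "finite {\<kappa> \<in> proper_multicolorings G \<alpha>.
      mfps_coeff (mfps_monom (color_monomial G \<kappa>) :: int mfps) m \<noteq> 0}"
    by (rule finite_subset[OF _ finite_colorings_of_monomial[OF assms, of m]])
       (auto simp: mfps_coeff_monom split: if_splits)
qed

lemma Y_summable:
  assumes "finite (verts G)" "A \<subseteq> vertex_weights G"
  shows "mfps_summable (X_series G) A"
  unfolding mfps_summable_def
proof
  fix m
  let ?K = "{\<kappa>. (\<exists>\<alpha>. \<kappa> \<in> proper_multicolorings G \<alpha>) \<and> color_monomial G \<kappa> = m}"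
  have "{\<alpha> \<in> A. mfps_coeff (X_series G \<alpha>) m \<noteq> 0}
      \<subseteq> (\<lambda>\<kappa>. restrict (\<lambda>w. card (\<kappa> w)) (verts G)) ` ?K"
  proof clarify
    fix \<alpha> assume a: "\<alpha> \<in> A" and nz: "mfps_coeff (X_series G \<alpha>) m \<noteq> 0"
    have "\<exists>\<kappa>\<in>proper_multicolorings G \<alpha>. color_monomial G \<kappa> = m"
    proof (rule ccontr)
      assume "\<not> ?thesis"
      then have "{\<kappa> \<in> proper_multicolorings G \<alpha>.
          mfps_coeff (mfps_monom (color_monomial G \<kappa>) :: int mfps) m \<noteq> 0} = {}"
        by (auto simp: mfps_coeff_monom)
      with nz show False
        by (simp add: X_series_def mfps_coeff_sum sum.G_def)
    qed
    then obtain \<kappa> where k: "\<kappa> \<in> proper_multicolorings G \<alpha>" "color_monomial G \<kappa> = m" by blast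
    have "\<alpha> = restrict (\<lambda>w. card (\<kappa> w)) (verts G)"
      using k(1) a assms(2)
      by (intro ext)
         (auto simp: proper_multicolorings_def multicolorings_def vertex_weights_def PiE_iff
            extensional_def)
    then show "\<alpha> \<in> (\<lambda>\<kappa>. restrict (\<lambda>w. card (\<kappa> w)) (verts G)) ` ?K"
      using k by blast
  qed
  then show "finite {\<alpha> \<in> A. mfps_coeff (X_series G \<alpha>) m \<noteq> 0}"
    by (rule finite_subset) (intro finite_imageI finite_colorings_of_monomial assms(1))
qed

end

theory Submission
  imports Defs
begin

text \<open>
  Each sum in the statement is the generating function, by monomial, of a set of proper
  multicolorings. Those of \<open>G\<close> fall into three classes: \<open>v\<close> receives no color; \<open>v\<close> receives a color
  but its neighbors receive none; \<open>v\<close> and some neighbor both receive colors. The first class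
  restricts bijectively to the multicolorings of \<open>G - v\<close>, and a member of the second is a pair of a
  nonempty color set for \<open>v\<close> and an arbitrary proper multicoloring of \<open>G - N[v]\<close>.
\<close>

section \<open>Generating functions of weighted sets\<close>

text \<open>The index type and the weight are arbitrary, so that pairs of multicolorings can be
  enumerated in the same way as multicolorings. \<open>X_series\<close> is by definition an
  instance.\<close>

definition monom_gf :: "('i \<Rightarrow> monomial) \<Rightarrow> 'i set \<Rightarrow> 'a::comm_ring_1 mfps" where
  "monom_gf w S = mfps_sum (\<lambda>s. mfps_monom (w s)) S"

text \<open>If infinitely many elements have weight \<open>m\<close>, both sides are 0: the default
  values of \<open>sum'\<close> and of \<open>card\<close> agree.\<close>

lemma coeff_monom_gf:
  "mfps_coeff (monom_gf w S :: 'a::comm_ring_1 mfps) m = of_nat (card {s \<in> S. w s = m})"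
proof -
  have "{s \<in> S. mfps_coeff (mfps_monom (w s) :: 'a mfps) m \<noteq> 0} = {s \<in> S. w s = m}"
    by (auto simp: mfps_coeff_monom)
  then show ?thesis
    by (simp add: monom_gf_def mfps_coeff_sum sum.G_def mfps_coeff_monom)
qed

lemma monom_gf_Un_disjoint:
  assumes "\<And>m. finite {s \<in> S. w s = m}" "\<And>m. finite {s \<in> T. w s = m}" "S \<inter> T = {}"
  shows "monom_gf w (S \<union> T) = (monom_gf w S + monom_gf w T :: 'a::comm_ring_1 mfps)"
proof (rule mfps_eqI)
  fix m
  have "{s \<in> S \<union> T. w s = m} = {s \<in> S. w s = m} \<union> {s \<in> T. w s = m}" by auto
  then have "card {s \<in> S \<union> T. w s = m} = card {s \<in> S. w s = m} + card {s \<in> T. w s = m}"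
    using assms by (subst card_Un_disjoint[symmetric]) auto
  then show "mfps_coeff (monom_gf w (S \<union> T)) m
      = mfps_coeff (monom_gf w S + monom_gf w T :: 'a mfps) m"
    by (simp add: coeff_monom_gf plus_mfps.rep_eq)
qed

text \<open>A weight-preserving bijection restricts to a bijection between the fibers over each
  monomial.\<close>

lemma monom_gf_bij_betw:
  assumes "bij_betw f S T" "\<And>s. s \<in> S \<Longrightarrow> w' (f s) = w s"
  shows "monom_gf w' T = monom_gf w S"
proof (rule mfps_eqI)
  fix m
  have "bij_betw f {s \<in> S. w s = m} {t \<in> T. w' t = m}"
    using assms by (auto simp: bij_betw_def inj_on_def)
  then show "mfps_coeff (monom_gf w' T) m = mfps_coeff (monom_gf w S) m"
    by (simp add: coeff_monom_gf bij_betw_same_card)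
qed

text \<open>The pairs of total weight \<open>m\<close> are the disjoint union, over all
  factorizations of \<open>m\<close> into two monomials, of products of fibers. Counting them gives
  the convolution that defines the product of series.\<close>

lemma monom_gf_Times:
  assumes "\<And>m. finite {s \<in> S. w s = m}" "\<And>m. finite {t \<in> T. w' t = m}"
  shows "monom_gf (\<lambda>(s, t). w s + w' t) (S \<times> T)
    = (monom_gf w S * monom_gf w' T :: 'a::comm_ring_1 mfps)"
proof (rule mfps_eqI)
  fix m
  let ?P = "\<lambda>p. {s \<in> S. w s = fst p} \<times> {t \<in> T. w' t = snd p}"
  have "{p \<in> S \<times> T. (case p of (s, t) \<Rightarrow> w s + w' t) = m} = (\<Union>p\<in>mono_splits m. ?P p)"
    by (auto simp: mono_splits_def)
  also have "card \<dots> = (\<Sum>p\<in>mono_splits m. card (?P p))"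
    using assms finite_mono_splits by (intro card_UN_disjoint) auto
  finally show "mfps_coeff (monom_gf (\<lambda>(s, t). w s + w' t) (S \<times> T)) m
      = mfps_coeff (monom_gf w S * monom_gf w' T :: 'a mfps) m"
    by (simp add: coeff_monom_gf times_mfps.rep_eq card_cartesian_product case_prod_unfold)
qed

lemma monom_gf_singleton: "w s = 0 \<Longrightarrow> monom_gf w {s} = 1"
  by (rule mfps_eqI) (auto simp: coeff_monom_gf one_mfps.rep_eq card_eq_0_iff
      conj_commute cong: conj_cong)

section \<open>Proper multicolorings of arbitrary type\<close>

text \<open>Forgetting the type turns the double sum over types and multicolorings into a sum over a
  single set.\<close>

definition colorings :: "'v sgraph \<Rightarrow> ('v \<Rightarrow> nat set) set" where
  "colorings G = {\<kappa> \<in> verts G \<rightarrow>\<^sub>E {C. finite C \<and> C \<subseteq> {1..}}.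
     \<forall>u w. {u, w} \<in> edges G \<longrightarrow> \<kappa> u \<inter> \<kappa> w = {}}"

text \<open>Restricted to the vertices, so that the type is itself an element of
  \<open>vertex_weights G\<close>.\<close>

definition coloring_type :: "'v sgraph \<Rightarrow> ('v \<Rightarrow> nat set) \<Rightarrow> 'v \<Rightarrow> nat" where
  "coloring_type G \<kappa> = (\<lambda>w\<in>verts G. card (\<kappa> w))"

lemma coloring_type_in_weights: "coloring_type G \<kappa> \<in> vertex_weights G"
  by (simp add: coloring_type_def vertex_weights_def)

lemma proper_multicolorings_eq:
  assumes "\<alpha> \<in> vertex_weights G"
  shows "proper_multicolorings G \<alpha> = {\<kappa> \<in> colorings G. coloring_type G \<kappa> = \<alpha>}"
  using assms
  by (fastforce simp: proper_multicolorings_def multicolorings_def colorings_def coloring_type_def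
      vertex_weights_def PiE_iff extensional_def fun_eq_iff)

lemma coloring_proper:
  assumes "\<kappa> \<in> colorings G"
  shows "\<kappa> \<in> proper_multicolorings G (coloring_type G \<kappa>)"
  using assms by (simp add: proper_multicolorings_eq coloring_type_in_weights)

lemma lookup_color_monomial':
  assumes "finite (verts G)" "\<kappa> \<in> colorings G"
  shows "Poly_Mapping.lookup (color_monomial G \<kappa>) i = card {w \<in> verts G. i \<in> \<kappa> w}"
  using coloring_proper[OF assms(2)]
  by (intro lookup_color_monomial[OF assms(1), of _ "coloring_type G \<kappa>"]) (simp add: proper_multicolorings_def)

text \<open>The nested comprehension matches the finiteness premises of
  \<open>monom_gf_Un_disjoint\<close>.\<close>

lemma finite_color_fiber:
  assumes "finite (verts G)"
  shows "finite {\<kappa> \<in> {\<kappa> \<in> colorings G. P \<kappa>}. color_monomial G \<kappa> = m}"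
  by (rule finite_subset[OF _ finite_colorings_of_monomial[OF assms, of m]])
     (auto intro: coloring_proper)

text \<open>Every multicoloring has exactly one type, so the fiber over a monomial is partitioned by
  type, and only finitely many types contribute to it.\<close>

lemma mfps_sum_X_series:
  assumes "finite (verts G)" "A \<subseteq> vertex_weights G"
  shows "mfps_sum (X_series G) A
    = monom_gf (color_monomial G) {\<kappa> \<in> colorings G. coloring_type G \<kappa> \<in> A}"
proof (rule mfps_eqI)
  fix m
  let ?K = "\<lambda>\<alpha>. {\<kappa> \<in> proper_multicolorings G \<alpha>. color_monomial G \<kappa> = m}"
  have X: "mfps_coeff (X_series G \<alpha>) m = int (card (?K \<alpha>))" for \<alpha>
    unfolding X_series_def monom_gf_def[symmetric] by (simp add: coeff_monom_gf)
  \<comment> \<open>The support over which \<open>sum'\<close> sums; its finiteness is the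
    summability of the series.\<close>
  let ?B = "{\<alpha> \<in> A. card (?K \<alpha>) \<noteq> 0}"
  have fB: "finite ?B"
    using Y_summable[OF assms, unfolded mfps_summable_def, rule_format, of m] by (simp add: X)
  have fK: "finite (?K \<alpha>)" for \<alpha>
    by (rule finite_subset[OF _ finite_colorings_of_monomial[OF assms(1), of m]]) auto
  have K: "?K \<alpha> = {\<kappa> \<in> colorings G. coloring_type G \<kappa> = \<alpha> \<and> color_monomial G \<kappa> = m}"
    if "\<alpha> \<in> A" for \<alpha>
    using that assms(2) by (auto simp: proper_multicolorings_eq)
  have "{\<kappa> \<in> {\<kappa> \<in> colorings G. coloring_type G \<kappa> \<in> A}. color_monomial G \<kappa> = m}
      = (\<Union>\<alpha>\<in>A. ?K \<alpha>)"
    using K by auto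
  \<comment> \<open>Since the fibers are finite, cardinality 0 really means empty here.\<close>
  also have "\<dots> = (\<Union>\<alpha>\<in>?B. ?K \<alpha>)"
    using fK by (auto simp: card_eq_0_iff)
  also have "card \<dots> = (\<Sum>\<alpha>\<in>?B. card (?K \<alpha>))"
  proof (intro card_UN_disjoint ballI impI)
    fix \<alpha> \<beta> assume "\<alpha> \<in> ?B" "\<beta> \<in> ?B" "\<alpha> \<noteq> \<beta>"
    then show "?K \<alpha> \<inter> ?K \<beta> = {}" using K[of \<alpha>] K[of \<beta>] by auto
  qed (use fB fK in auto)
  finally show "mfps_coeff (mfps_sum (X_series G) A) m = mfps_coeff
      (monom_gf (color_monomial G) {\<kappa> \<in> colorings G. coloring_type G \<kappa> \<in> A} :: int mfps) m"
    using fB by (simp add: mfps_coeff_sum sum.G_def X coeff_monom_gf)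
qed

lemma Y_series_eq_monom_gf:
  assumes "finite (verts G)"
  shows "Y_series G = monom_gf (color_monomial G) (colorings G)"
  using mfps_sum_X_series[OF assms subset_refl]
  by (simp add: Y_series_def coloring_type_in_weights)

text \<open>The subtracted 1 is the monomial of the only multicoloring that gives \<open>v\<close>
  no color.\<close>

lemma Y_series_single_vertex_minus_1:
  "Y_series (single_vertex v) - 1
    = monom_gf (color_monomial (single_vertex v)) {\<kappa> \<in> colorings (single_vertex v). \<kappa> v \<noteq> {}}"
proof -
  let ?H = "single_vertex v"
  let ?E = "{\<kappa> \<in> colorings ?H. \<kappa> v = {}}" and ?N = "{\<kappa> \<in> colorings ?H. \<kappa> v \<noteq> {}}"
  have fin: "finite (verts ?H)" by (simp add: single_vertex_def)
  have split: "colorings ?H = ?E \<union> ?N" by auto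
  have E: "?E = {\<lambda>w\<in>{v}. {}}"
    by (auto simp: colorings_def single_vertex_def PiE_iff extensional_def fun_eq_iff)
  then have "(\<lambda>w\<in>{v}. {}) \<in> colorings ?H" by blast
  then have "color_monomial ?H (\<lambda>w\<in>{v}. {}) = 0"
    by (intro poly_mapping_eqI, subst lookup_color_monomial'[OF fin])
       (auto simp: single_vertex_def)
  then have one: "monom_gf (color_monomial ?H) ?E = (1 :: int mfps)"
    unfolding E by (rule monom_gf_singleton[where w = "color_monomial ?H"])
  have "Y_series ?H = monom_gf (color_monomial ?H) (?E \<union> ?N)"
    using Y_series_eq_monom_gf[OF fin] split by simp
  also have "\<dots> = monom_gf (color_monomial ?H) ?E + monom_gf (color_monomial ?H) ?N"
    by (intro monom_gf_Un_disjoint finite_color_fiber fin) auto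
  finally show ?thesis by (simp add: one)
qed

section \<open>Restricting and extending multicolorings along vertex deletion\<close>

lemma simple_graph_edgeD:
  assumes "finite_simple_graph G" "{u, w} \<in> edges G"
  shows "u \<in> verts G" "w \<in> verts G" "u \<noteq> w"
  using assms unfolding finite_simple_graph_def by (force simp: doubleton_eq_iff)+

lemma restrict_coloring:
  assumes "finite_simple_graph G" "\<kappa> \<in> colorings G"
  shows "restrict \<kappa> (verts (del_verts G S)) \<in> colorings (del_verts G S)"
proof -
  have "restrict \<kappa> (verts (del_verts G S)) u \<inter> restrict \<kappa> (verts (del_verts G S)) w = {}"
    if "{u, w} \<in> edges (del_verts G S)" for u w
  proof -
    have e: "{u, w} \<in> edges G" "u \<notin> S" "w \<notin> S" using that by (auto simp: del_verts_def)
    then show ?thesis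
      using assms(2) simple_graph_edgeD[OF assms(1) e(1)]
      by (simp add: colorings_def del_verts_def)
  qed
  then show ?thesis
    using assms(2) by (simp add: colorings_def del_verts_def PiE_iff)
qed

text \<open>Extension by the empty set on \<open>S\<close> inverts restriction to the remaining
  vertices. Uncolored vertices contribute nothing to the monomial, and edges meeting
  \<open>S\<close> impose no condition.\<close>

lemma monom_gf_uncolored:
  assumes "finite_simple_graph G" "S \<subseteq> verts G"
  shows "monom_gf (color_monomial G) {\<kappa> \<in> colorings G. \<forall>w\<in>S. \<kappa> w = {}}
    = Y_series (del_verts G S)"
proof -
  let ?H = "del_verts G S"
  let ?f = "\<lambda>\<kappa>. \<lambda>w\<in>verts G. if w \<in> S then {} else \<kappa> w"
  have fin: "finite (verts G)" using assms(1) by (simp add: finite_simple_graph_def)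
  have finH: "finite (verts ?H)" using fin by (simp add: del_verts_def)
  have f: "?f \<kappa> \<in> colorings G" if "\<kappa> \<in> colorings ?H" for \<kappa>
  proof -
    have "?f \<kappa> u \<inter> ?f \<kappa> w = {}" if "{u, w} \<in> edges G" for u w
      using that \<open>\<kappa> \<in> _\<close> simple_graph_edgeD[OF assms(1) that]
      by (simp add: colorings_def del_verts_def)
    then show ?thesis using that by (simp add: colorings_def del_verts_def PiE_iff)
  qed
  have bij: "bij_betw ?f (colorings ?H) {\<kappa> \<in> colorings G. \<forall>w\<in>S. \<kappa> w = {}}"
  proof (rule bij_betw_byWitness[where f' = "\<lambda>\<kappa>. restrict \<kappa> (verts ?H)"])
    show "?f ` colorings ?H \<subseteq> {\<kappa> \<in> colorings G. \<forall>w\<in>S. \<kappa> w = {}}"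
      using f assms(2) by auto
    show "(\<lambda>\<kappa>. restrict \<kappa> (verts ?H)) ` {\<kappa> \<in> colorings G. \<forall>w\<in>S. \<kappa> w = {}} \<subseteq> colorings ?H"
      using restrict_coloring[OF assms(1)] by auto
  qed (auto simp: colorings_def del_verts_def PiE_iff extensional_def fun_eq_iff)
  have "color_monomial G (?f \<kappa>) = color_monomial ?H \<kappa>" if k: "\<kappa> \<in> colorings ?H" for \<kappa>
  proof (rule poly_mapping_eqI)
    fix i
    have "{w \<in> verts G. i \<in> ?f \<kappa> w} = {w \<in> verts ?H. i \<in> \<kappa> w}"
      by (auto simp: del_verts_def)
    then show "Poly_Mapping.lookup (color_monomial G (?f \<kappa>)) i
        = Poly_Mapping.lookup (color_monomial ?H \<kappa>) i"
      by (simp only: lookup_color_monomial'[OF fin f[OF k]] lookup_color_monomial'[OF finH k])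
  qed
  then show ?thesis
    unfolding Y_series_eq_monom_gf[OF finH] by (rule monom_gf_bij_betw[OF bij])
qed

text \<open>Once the neighbors of \<open>v\<close> are uncolored, the edges at \<open>v\<close>
  impose no condition, so the colors of \<open>v\<close> and those outside \<open>N[v]\<close> are
  chosen independently. This yields the product.\<close>

lemma monom_gf_isolated:
  assumes "finite_simple_graph G" "v \<in> verts G"
  shows "monom_gf (color_monomial G) {\<kappa> \<in> colorings G. \<kappa> v \<noteq> {} \<and> (\<forall>u\<in>nbrs G v. \<kappa> u = {})}
    = (Y_series (single_vertex v) - 1) * Y_series (del_verts G (closed_nbrs G v))"
proof -
  let ?H = "single_vertex v" and ?D = "del_verts G (closed_nbrs G v)"
  let ?S = "{\<kappa> \<in> colorings ?H. \<kappa> v \<noteq> {}}"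
  let ?T = "{\<kappa> \<in> colorings G. \<kappa> v \<noteq> {} \<and> (\<forall>u\<in>nbrs G v. \<kappa> u = {})}"
  let ?f = "\<lambda>(\<kappa>, \<mu>). \<lambda>w\<in>verts G. if w = v then \<kappa> v else if w \<in> nbrs G v then {} else \<mu> w"
  let ?w = "\<lambda>(\<kappa>, \<mu>). color_monomial ?H \<kappa> + color_monomial ?D \<mu>"
  have fin: "finite (verts G)" using assms(1) by (simp add: finite_simple_graph_def)
  have finH: "finite (verts ?H)" by (simp add: single_vertex_def)
  have finD: "finite (verts ?D)" using fin by (simp add: del_verts_def)
  note edge = simple_graph_edgeD[OF assms(1)]
  have nb: "u \<in> nbrs G v \<Longrightarrow> u \<in> verts G \<and> u \<noteq> v" for u
    using edge[of v u] by (auto simp: nbrs_def)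
  have f: "?f (\<kappa>, \<mu>) \<in> colorings G" if "\<kappa> \<in> colorings ?H" "\<mu> \<in> colorings ?D" for \<kappa> \<mu>
  proof -
    have "?f (\<kappa>, \<mu>) u \<inter> ?f (\<kappa>, \<mu>) w = {}" if e: "{u, w} \<in> edges G" for u w
    \<comment> \<open>An edge meeting \<open>N[v]\<close> has an end in \<open>N(v)\<close>, which
      is uncolored; any other edge survives in \<open>?D\<close>.\<close>
    proof (cases "u = v \<or> w = v \<or> u \<in> nbrs G v \<or> w \<in> nbrs G v")
      case True
      then show ?thesis using e edge[OF e] by (auto simp: nbrs_def insert_commute)
    next
      case False
      then have "{u, w} \<in> edges ?D" using e by (auto simp: del_verts_def closed_nbrs_def)
      then have "\<mu> u \<inter> \<mu> w = {}" using \<open>\<mu> \<in> _\<close> by (auto simp: colorings_def)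
      then show ?thesis using False edge[OF e] by auto
    qed
    moreover have "?f (\<kappa>, \<mu>) \<in> verts G \<rightarrow>\<^sub>E {C. finite C \<and> C \<subseteq> {1..}}"
      using that
      by (auto simp: colorings_def single_vertex_def del_verts_def closed_nbrs_def PiE_iff)
    ultimately show ?thesis by (simp add: colorings_def)
  qed
  have bij: "bij_betw ?f (?S \<times> colorings ?D) ?T"
  proof (rule bij_betw_byWitness[where
        f' = "\<lambda>\<kappa>. (restrict \<kappa> {v}, restrict \<kappa> (verts ?D))"])
    show "?f ` (?S \<times> colorings ?D) \<subseteq> ?T"
      using f assms(2) nb by auto
    show "(\<lambda>\<kappa>. (restrict \<kappa> {v}, restrict \<kappa> (verts ?D))) ` ?T \<subseteq> ?S \<times> colorings ?D"
    proof (clarsimp, intro conjI)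
      fix \<kappa> assume k: "\<kappa> \<in> colorings G"
      show "restrict \<kappa> {v} \<in> colorings ?H"
        using k assms(2) by (auto simp: colorings_def single_vertex_def PiE_iff)
      show "restrict \<kappa> (verts ?D) \<in> colorings ?D"
        using assms(1) k by (rule restrict_coloring)
    qed
  qed (use assms(2) in \<open>auto simp: colorings_def single_vertex_def del_verts_def closed_nbrs_def
        PiE_iff extensional_def fun_eq_iff\<close>)
  have w: "color_monomial G (?f p) = ?w p" if "p \<in> ?S \<times> colorings ?D" for p
  proof (rule poly_mapping_eqI)
    fix i
    obtain \<kappa> \<mu> where p: "p = (\<kappa>, \<mu>)" and k: "\<kappa> \<in> colorings ?H" and m: "\<mu> \<in> colorings ?D"
      using \<open>p \<in> _\<close> by auto
    \<comment> \<open>The neighbors of \<open>v\<close> drop out, so a color is used either at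
      \<open>v\<close> or outside \<open>N[v]\<close>, and the exponents add.\<close>
    have "{w \<in> verts G. i \<in> ?f p w} = {w \<in> verts ?H. i \<in> \<kappa> w} \<union> {w \<in> verts ?D. i \<in> \<mu> w}"
      using assms(2) by (auto simp: p single_vertex_def del_verts_def closed_nbrs_def)
    also have "card \<dots> = card {w \<in> verts ?H. i \<in> \<kappa> w} + card {w \<in> verts ?D. i \<in> \<mu> w}"
    proof (rule card_Un_disjoint)
      show "{w \<in> verts ?H. i \<in> \<kappa> w} \<inter> {w \<in> verts ?D. i \<in> \<mu> w} = {}"
        by (auto simp: single_vertex_def del_verts_def closed_nbrs_def)
    qed (use finH finD in simp_all)
    finally show "Poly_Mapping.lookup (color_monomial G (?f p)) i = Poly_Mapping.lookup (?w p) i"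
      using lookup_color_monomial'[OF fin f[OF k m]] lookup_color_monomial'[OF finH k]
        lookup_color_monomial'[OF finD m] by (simp add: p lookup_add)
  qed
  have "monom_gf (color_monomial G) ?T = (monom_gf ?w (?S \<times> colorings ?D) :: int mfps)"
    using w by (intro monom_gf_bij_betw[OF bij])
  also have "\<dots> = monom_gf (color_monomial ?H) ?S * monom_gf (color_monomial ?D) (colorings ?D)"
    using finite_color_fiber[OF finH] finite_color_fiber[OF finD, of "\<lambda>_. True"]
    by (intro monom_gf_Times) auto
  finally show ?thesis
    by (simp add: Y_series_single_vertex_minus_1 Y_series_eq_monom_gf[OF finD])
qed

theorem proposition3p3:
  fixes G :: "'v sgraph" and v :: 'v
  assumes "finite_simple_graph G" and "v \<in> verts G"
  shows "Y_series G =
      Y_series (del_verts G {v})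
    + (Y_series (single_vertex v) - 1) * Y_series (del_verts G (closed_nbrs G v))
    + mfps_sum (X_series G)
        {\<alpha> \<in> vertex_weights G. \<alpha> v \<ge> 1 \<and> (\<exists>u\<in>nbrs G v. \<alpha> u \<ge> 1)}"
proof -
  have fin: "finite (verts G)" using assms(1) by (simp add: finite_simple_graph_def)
  let ?gf = "monom_gf (color_monomial G) :: _ \<Rightarrow> int mfps"
  \<comment> \<open>The quantifier over \<open>{v}\<close> gives the form of
    \<open>monom_gf_uncolored\<close> with \<open>S = {v}\<close>.\<close>
  let ?A = "{\<kappa> \<in> colorings G. \<forall>w\<in>{v}. \<kappa> w = {}}"
  let ?B = "{\<kappa> \<in> colorings G. \<kappa> v \<noteq> {} \<and> (\<forall>u\<in>nbrs G v. \<kappa> u = {})}"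
  let ?C = "{\<kappa> \<in> colorings G. \<kappa> v \<noteq> {} \<and> (\<exists>u\<in>nbrs G v. \<kappa> u \<noteq> {})}"
  let ?W = "{\<alpha> \<in> vertex_weights G. \<alpha> v \<ge> 1 \<and> (\<exists>u\<in>nbrs G v. \<alpha> u \<ge> 1)}"
  \<comment> \<open>Color sets are finite, so a nonempty one has positive cardinality. This
    translates the conditions on \<alpha> into conditions on \<kappa>.\<close>
  have type: "coloring_type G \<kappa> w \<ge> 1 \<longleftrightarrow> \<kappa> w \<noteq> {}" if "\<kappa> \<in> colorings G" "w \<in> verts G" for \<kappa> w
    using that by (auto simp: coloring_type_def colorings_def PiE_iff Suc_le_eq card_gt_0_iff)
  have nb: "u \<in> verts G" if "u \<in> nbrs G v" for u
    using that simple_graph_edgeD[OF assms(1)] by (auto simp: nbrs_def)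
  have "{\<kappa> \<in> colorings G. coloring_type G \<kappa> \<in> ?W} = ?C"
    using type assms(2) nb coloring_type_in_weights by blast
  then have C: "mfps_sum (X_series G) ?W = ?gf ?C"
    by (subst mfps_sum_X_series[OF fin]) auto
  have "colorings G = ?A \<union> {\<kappa> \<in> colorings G. \<kappa> v \<noteq> {}}" by auto
  then have "Y_series G = ?gf (?A \<union> {\<kappa> \<in> colorings G. \<kappa> v \<noteq> {}})"
    using Y_series_eq_monom_gf[OF fin] by simp
  also have "\<dots> = ?gf ?A + ?gf {\<kappa> \<in> colorings G. \<kappa> v \<noteq> {}}"
    by (intro monom_gf_Un_disjoint finite_color_fiber fin) auto
  also have "{\<kappa> \<in> colorings G. \<kappa> v \<noteq> {}} = ?B \<union> ?C" by auto
  also have "?gf (?B \<union> ?C) = ?gf ?B + ?gf ?C"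
    by (intro monom_gf_Un_disjoint finite_color_fiber fin) auto
  finally show ?thesis
    using monom_gf_uncolored[OF assms(1), of "{v}"] monom_gf_isolated[OF assms] C assms(2)
    by (simp add: add.assoc)
qed

end
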